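(* Let $(X,d)$ be a compact metric space, let $n\ge 1$, let $f_1,\dots,f_n:X\to X$ be continuous surjective maps, and let $(X,\mathbb{F})$ be the non-autonomous dynamical system generated by the finite family $\mathbb{F}=\{f_1,\dots,f_n\}$. If the set of periodic points of the autonomous system $(X,\,f_n\circ f_{n-1}\circ\cdots\circ f_1)$ is dense in $X$, then the set of periodic points of $(X,\mathbb{F})$ is dense in $X$.
   Context: $\mathbb{N}$ denotes the positive integers. The non-autonomous system generated by the finite ordered family $\mathbb{F}=\{f_1,\dots,f_n\}$ is obtained by repeating the maps cyclically: for every $k\ge1$ put $f_k=f_{1+((k-1)\bmod n)}$, and let $\omega_k=f_k\circ f_{k-1}\circ\cdots\circ f_1$ be the state map after $k$ iterations. A point $x\in X$ is periodic for $\mathbb{F}$ if there exists $m\in\mathbb{N}$ such that $\omega_{mk}(x)=x$ for all $k\in\mathbb{N}$. A point $x$ is periodic for the autonomous system $(X,g)$ if $g^m(x)=x$ for some $m\in\mathbb{N}$. *)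

theory Defs
  imports "HOL-Analysis.Analysis"
begin

text \<open>Indices start at \<open>1\<close>: a sequence of maps is \<open>F 1, F 2, \<dots>\<close>, and the value \<open>F 0\<close> is
  never used.  Thus \<open>state_map F k = F k \<circ> \<dots> \<circ> F 1\<close>.\<close>

primrec state_map :: "(nat \<Rightarrow> 'a \<Rightarrow> 'a) \<Rightarrow> nat \<Rightarrow> 'a \<Rightarrow> 'a" where
  "state_map F 0 = id"
| "state_map F (Suc k) = F (Suc k) \<circ> state_map F k"

text \<open>Only \<open>f 1, \<dots>, f n\<close> enter here when \<open>n \<ge> 1\<close> and \<open>k \<ge> 1\<close>.\<close>

definition cyclic_extension :: "nat \<Rightarrow> (nat \<Rightarrow> 'a \<Rightarrow> 'a) \<Rightarrow> nat \<Rightarrow> 'a \<Rightarrow> 'a" where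
  "cyclic_extension n f k = f (1 + (k - 1) mod n)"

definition nonautonomous_periodic_points :: "'a set \<Rightarrow> (nat \<Rightarrow> 'a \<Rightarrow> 'a) \<Rightarrow> 'a set" where
  "nonautonomous_periodic_points X F =
     {x \<in> X. \<exists>m\<ge>1. \<forall>k\<ge>1. state_map F (m * k) x = x}"

definition autonomous_periodic_points :: "'a set \<Rightarrow> ('a \<Rightarrow> 'a) \<Rightarrow> 'a set" where
  "autonomous_periodic_points X g = {x \<in> X. \<exists>m\<ge>1. (g ^^ m) x = x}"

definition dense_in_space :: "'a topology \<Rightarrow> 'a set \<Rightarrow> bool" where
  "dense_in_space T S \<longleftrightarrow> S \<subseteq> topspace T \<and> T closure_of S = topspace T"

end

theory Submission
  imports Defs
begin

text \<open>Put \<open>g = state_map f n\<close>. The cyclic family starts afresh after every block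
  of \<open>n\<close> maps, so its state map at time \<open>n * j\<close> is the iterate
  \<open>g ^^ j\<close>. A point fixed by \<open>g ^^ m\<close> therefore returns at every multiple
  of \<open>n * m\<close>, so periodic points of \<open>g\<close> are periodic for the family. A set
  containing a dense set is dense.\<close>

lemma state_map_cyclic_extension_add:
  assumes "r \<le> n"
  shows "state_map (cyclic_extension n f) (n * j + r) =
    state_map f r \<circ> state_map (cyclic_extension n f) (n * j)"
  \<comment> \<open>For \<open>Suc r \<le> n\<close> the index \<open>n * j + Suc r\<close>, lowered
    by 1, has residue \<open>r\<close> modulo \<open>n\<close>, so the next map is
    \<open>f (Suc r)\<close>.\<close>
  using assms by (induction r) (auto simp: cyclic_extension_def)

lemma state_map_cyclic_extension_mult:
  "state_map (cyclic_extension n f) (n * j) = state_map f n ^^ j"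
proof (induction j)
  case (Suc j)
  then show ?case
    \<comment> \<open>The extreme case \<open>r = n\<close> adds one full block, that is, one more
      factor \<open>g\<close>.\<close>
    using state_map_cyclic_extension_add [of n n f j] by (simp add: add.commute)
qed simp

lemma autonomous_subset_nonautonomous_periodic_points:
  assumes "n \<ge> 1"
  shows "autonomous_periodic_points X (state_map f n)
    \<subseteq> nonautonomous_periodic_points X (cyclic_extension n f)"
proof
  fix x assume "x \<in> autonomous_periodic_points X (state_map f n)"
  then obtain m where x: "x \<in> X" and m: "m \<ge> 1" "(state_map f n ^^ m) x = x"
    by (auto simp: autonomous_periodic_points_def)
  \<comment> \<open>The period \<open>n * m\<close> counts single maps: \<open>m\<close> blocks of
    length \<open>n\<close>.\<close>
  have "state_map (cyclic_extension n f) (n * m * k) x = x" for k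
  proof -
    have "((state_map f n ^^ m) ^^ k) x = x"
      using m(2) by (induction k) auto
    then show ?thesis
      by (simp add: state_map_cyclic_extension_mult mult.assoc funpow_mult mult.commute [of m])
  qed
  moreover have "n * m \<ge> 1"
    using assms m(1) by simp
  ultimately show "x \<in> nonautonomous_periodic_points X (cyclic_extension n f)"
    using x unfolding nonautonomous_periodic_points_def by blast
qed

theorem lemma1:
  fixes X :: "'a set" and d :: "'a \<Rightarrow> 'a \<Rightarrow> real"
    and n :: nat and f :: "nat \<Rightarrow> 'a \<Rightarrow> 'a"
  assumes "Metric_space X d"
    and "compact_space (Metric_space.mtopology X d)"
    and "n \<ge> 1"
    and "\<And>i. i \<in> {1..n} \<Longrightarrow>
           continuous_map (Metric_space.mtopology X d) (Metric_space.mtopology X d) (f i)"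
    and "\<And>i. i \<in> {1..n} \<Longrightarrow> f i ` X = X"
    and "dense_in_space (Metric_space.mtopology X d)
           (autonomous_periodic_points X (state_map f n))"
  shows "dense_in_space (Metric_space.mtopology X d)
           (nonautonomous_periodic_points X (cyclic_extension n f))"
proof -
  interpret Metric_space X d by fact
  have "nonautonomous_periodic_points X (cyclic_extension n f) \<subseteq> X"
    by (auto simp: nonautonomous_periodic_points_def)
  \<comment> \<open>Closure is monotone, and the closure of the smaller set is already all of
    \<open>X\<close>.\<close>
  moreover have "X \<subseteq> mtopology closure_of nonautonomous_periodic_points X (cyclic_extension n f)"
    using assms(6) closure_of_mono
      [OF autonomous_subset_nonautonomous_periodic_points [OF \<open>n \<ge> 1\<close>, of X f], of mtopology]
    by (simp add: dense_in_space_def)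
  ultimately show ?thesis
    using closure_of_subset_topspace [of mtopology] by (auto simp: dense_in_space_def)
qed

end
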